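(* Let $|\Psi_{AB}\rangle$ be any pure entangled state in $\mathcal H^{d_A}\otimes\mathcal H^{d_B}$. There exists a set of $X$ one-click measurements on Alice's system, defined by their click effects $\{E_{+|x}\}_{x}$, such that the corresponding one-detector steering test will demonstrate steering whenever $$\epsilon>\frac1X .$$
   Context: $\mathcal H^{d}$ denotes a complex Hilbert space of finite dimension $d$. A pure state (unit vector) of $\mathcal H^{d_A}\otimes\mathcal H^{d_B}$ is entangled if it is not a product vector. One-click measurements: $X$ is the number of Alice's settings. For each setting $x\in\{0,\dots,X-1\}$ Alice performs a two-outcome POVM with outcomes $a\in\{+,\emptyset\}$ ("click" and "null"), with effects $E_{+|x}=\epsilon\,\Pi_{+|x}$ and $E_{\emptyset|x}=I_A-\epsilon\,\Pi_{+|x}$, where $\Pi_{+|x}$ is a rank-one orthogonal projector on $\mathcal H^{d_A}$ and $\epsilon\in[0,1]$ is the efficiency of Alice's single detector (the same for all $x$). Assemblage: in the one-detector steering test these measurements prepare for Bob the operators $\sigma_{a|x}=\mathrm{Tr}_A\big[(E_{a|x}\otimes I_B)\,|\Psi_{AB}\rangle\langle\Psi_{AB}|\big]$. Steering: the assemblage admits a local-hidden-state (LHS) model if there are an ensemble $\{p_\lambda,\rho_\lambda\}_\lambda$ of density operators on $\mathcal H^{d_B}$ and, for each $\lambda$ and $x$, a probability distribution $P_\lambda(\cdot|x)$ on $\{+,\emptyset\}$ such that $\sigma_{a|x}=\sum_\lambda p_\lambda P_\lambda(a|x)\rho_\lambda$ for all $a,x$. The test demonstrates steering if the assemblage admits no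 LHS model. *)

theory Defs
  imports "HOL-Analysis.Analysis"
begin

definition hadjoint :: "complex ^ 'n ^ 'm \<Rightarrow> complex ^ 'm ^ 'n" where
  "hadjoint A = (\<chi> i j. cnj (A $ j $ i))"

definition psd :: "complex ^ 'n ^ 'n \<Rightarrow> bool" where
  "psd A \<longleftrightarrow> hadjoint A = A \<and>
     (\<forall>v :: complex ^ 'n. 0 \<le> Re (\<Sum>i\<in>UNIV. cnj (v $ i) * (A *v v) $ i))"

definition density_operator :: "complex ^ 'n ^ 'n \<Rightarrow> bool" where
  "density_operator \<rho> \<longleftrightarrow> psd \<rho> \<and> trace \<rho> = 1"

definition rank_one_projector :: "complex ^ 'n ^ 'n \<Rightarrow> bool" where
  "rank_one_projector P \<longleftrightarrow> P ** P = P \<and> hadjoint P = P \<and> rank P = 1"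

definition ketbra :: "complex ^ 'n \<Rightarrow> complex ^ 'n ^ 'n" where
  "ketbra \<psi> = (\<chi> i j. \<psi> $ i * cnj (\<psi> $ j))"

(* The tensor product of complex ^ 'a and complex ^ 'b is complex ^ ('a \<times> 'b),
   the basis vector with index (i, j) being the product of the i-th and the j-th one. *)

definition tensor_vec ::
  "complex ^ 'a \<Rightarrow> complex ^ 'b \<Rightarrow> complex ^ ('a::finite \<times> 'b::finite)" where
  "tensor_vec u v = (\<chi> k. u $ fst k * v $ snd k)"

definition tensor_op ::
  "complex ^ 'a ^ 'a \<Rightarrow> complex ^ 'b ^ 'b \<Rightarrow> complex ^ ('a \<times> 'b) ^ ('a::finite \<times> 'b::finite)" where
  "tensor_op A B = (\<chi> k l. A $ fst k $ fst l * B $ snd k $ snd l)"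

definition partial_trace_A ::
  "complex ^ ('a::finite \<times> 'b::finite) ^ ('a \<times> 'b) \<Rightarrow> complex ^ 'b ^ 'b" where
  "partial_trace_A M = (\<chi> j l. \<Sum>i\<in>UNIV. M $ (i, j) $ (i, l))"

definition pure_state :: "complex ^ 'n \<Rightarrow> bool" where
  "pure_state \<psi> \<longleftrightarrow> norm \<psi> = 1"

definition entangled :: "complex ^ ('a::finite \<times> 'b::finite) \<Rightarrow> bool" where
  "entangled \<Psi> \<longleftrightarrow> \<not> (\<exists>u v. \<Psi> = tensor_vec u v)"

datatype outcome = Click | Null

definition one_click_measurements ::
  "nat \<Rightarrow> real \<Rightarrow> (nat \<Rightarrow> outcome \<Rightarrow> complex ^ 'a ^ 'a) \<Rightarrow> bool" where
  "one_click_measurements X \<epsilon> E \<longleftrightarrow>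
     (\<exists>P. \<forall>x<X. rank_one_projector (P x) \<and>
        E x Click = \<epsilon> *\<^sub>R P x \<and> E x Null = mat 1 - \<epsilon> *\<^sub>R P x)"

definition assemblage ::
  "complex ^ ('a::finite \<times> 'b::finite) \<Rightarrow> (nat \<Rightarrow> outcome \<Rightarrow> complex ^ 'a ^ 'a) \<Rightarrow>
     nat \<Rightarrow> outcome \<Rightarrow> complex ^ 'b ^ 'b" where
  "assemblage \<Psi> E x a = partial_trace_A (tensor_op (E x a) (mat 1) ** ketbra \<Psi>)"

(* The hidden variable l ranges over nat and the sums over it are convergent series: finite
   ensembles are included by taking p l = 0 for almost all l, countable ones directly, and larger
   discrete ones have only countably many l with p l > 0. *)

definition admits_LHS_model :: "nat \<Rightarrow> (nat \<Rightarrow> outcome \<Rightarrow> complex ^ 'b ^ 'b) \<Rightarrow> bool" where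
  "admits_LHS_model X \<sigma> \<longleftrightarrow>
     (\<exists>(p :: nat \<Rightarrow> real) (\<rho> :: nat \<Rightarrow> complex ^ 'b ^ 'b) (P :: nat \<Rightarrow> nat \<Rightarrow> outcome \<Rightarrow> real).
        (\<forall>l. 0 \<le> p l) \<and> p sums 1 \<and>
        (\<forall>l. density_operator (\<rho> l)) \<and>
        (\<forall>l. \<forall>x<X. (\<forall>a. 0 \<le> P l x a) \<and> P l x Click + P l x Null = 1) \<and>
        (\<forall>x<X. \<forall>a. (\<lambda>l. (p l * P l x a) *\<^sub>R \<rho> l) sums \<sigma> x a))"

definition demonstrates_steering :: "nat \<Rightarrow> (nat \<Rightarrow> outcome \<Rightarrow> complex ^ 'b ^ 'b) \<Rightarrow> bool" where
  "demonstrates_steering X \<sigma> \<longleftrightarrow> \<not> admits_LHS_model X \<sigma>"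

end

theory Submission
  imports Defs
begin

text \<open>
  A click on setting \<open>x\<close> steers Bob to a multiple of a pure state \<open>\<phi>\<^sub>x\<close>, and extremality of pure
  states forces every hidden state that contributes to the click to be that very state. If the
  \<open>\<phi>\<^sub>x\<close> are pairwise non-parallel, a hidden state can therefore click for one setting only, so an
  LHS model yields \<open>\<Sum>\<^sub>x \<sigma>\<^sub>+\<^sub>|\<^sub>x \<le> \<rho>\<^sub>B\<close>. Since \<open>\<Psi>\<close> is entangled, its coefficient matrix has two
  independent columns \<open>u\<close>, \<open>v\<close>. Let Alice project onto the normalised vectors \<open>u + t x v\<close>. For
  small \<open>t > 0\<close> these are distinct but nearly equal to \<open>u\<close>, so on the basis vector of column \<open>u\<close> the
  left-hand side of the inequality is close to \<open>\<epsilon> X \<parallel>u\<parallel>\<^sup>2\<close> while the right-hand side is \<open>\<parallel>u\<parallel>\<^sup>2\<close>.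
\<close>

subsection \<open>Hermitian product and quadratic forms\<close>

definition cdot :: "complex ^ 'n \<Rightarrow> complex ^ 'n \<Rightarrow> complex" where
  "cdot u v = (\<Sum>i\<in>UNIV. cnj (u $ i) * v $ i)"

lemma cdot_add_left: "cdot (u + v) w = cdot u w + cdot v w"
  by (simp add: cdot_def algebra_simps sum.distrib)

lemma cdot_add_right: "cdot u (v + w) = cdot u v + cdot u w"
  by (simp add: cdot_def algebra_simps sum.distrib)

lemma cdot_diff_left: "cdot (u - v) w = cdot u w - cdot v w"
  by (simp add: cdot_def algebra_simps sum_subtractf)

lemma cdot_diff_right: "cdot u (v - w) = cdot u v - cdot u w"
  by (simp add: cdot_def algebra_simps sum_subtractf)

lemma cdot_scale_left: "cdot (c *s u) v = cnj c * cdot u v"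
  by (simp add: cdot_def sum_distrib_left mult.assoc)

lemma cdot_scale_right: "cdot u (c *s v) = c * cdot u v"
  by (simp add: cdot_def sum_distrib_left mult_ac)

lemma cdot_commute: "cdot v u = cnj (cdot u v)"
  by (simp add: cdot_def mult.commute)

lemma cdot_self: "cdot u u = complex_of_real ((norm u)\<^sup>2)"
proof -
  have "(norm u)\<^sup>2 = (\<Sum>i\<in>UNIV. (norm (u $ i))\<^sup>2)"
    by (simp add: norm_vec_def L2_set_def sum_nonneg)
  then show ?thesis
    unfolding cdot_def
    by (simp only: of_real_sum) (simp add: complex_norm_square mult.commute del: of_real_power)
qed

lemma cdot_self_eq_0_iff [simp]: "cdot u u = 0 \<longleftrightarrow> u = 0"
  by (simp add: cdot_self)

lemma cdot_axis_left: "cdot (axis k 1) u = u $ k"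
proof -
  have "cdot (axis k 1) u = (\<Sum>i\<in>UNIV. if i = k then u $ i else 0)"
    unfolding cdot_def by (rule sum.cong) (auto simp: axis_def)
  then show ?thesis by simp
qed

lemma scaleR_eq_vector_scalar_mult: "r *\<^sub>R (u :: complex ^ 'n) = complex_of_real r *s u"
  by (simp add: vec_eq_iff) (simp add: scaleR_conv_of_real)

text \<open>Operator inequalities are only ever tested through this number. Taking the real part
  makes it real-valued for every matrix, Hermitian or not.\<close>

definition qform :: "complex ^ 'n ^ 'n \<Rightarrow> complex ^ 'n \<Rightarrow> real" where
  "qform A v = Re (cdot v (A *v v))"

lemma psd_qform_nonneg: "psd A \<Longrightarrow> 0 \<le> qform A v"
  by (simp add: psd_def qform_def cdot_def)

text \<open>Turns a convergent series of hidden-state operators into a scalar series, where termwise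
  comparison is available.\<close>

lemma bounded_linear_qform: "bounded_linear (\<lambda>A. qform A v)"
proof -
  have scale: "(r *\<^sub>R A) *v v = complex_of_real r *s (A *v v)" for r A
    by (simp add: vec_eq_iff matrix_vector_mult_def)
      (simp add: sum_distrib_left scaleR_conv_of_real mult.assoc)
  have "linear (\<lambda>A. qform A v)"
    by (rule linearI)
      (simp_all add: qform_def matrix_vector_mult_add_rdistrib cdot_add_right scale cdot_scale_right)
  then show ?thesis by (simp add: linear_conv_bounded_linear)
qed

lemma qform_add: "qform (A + B) v = qform A v + qform B v"
  by (simp add: linear_add [OF bounded_linear.linear [OF bounded_linear_qform]])

lemma qform_scaleR: "qform (r *\<^sub>R A) v = r * qform A v"
  using linear_scale [OF bounded_linear.linear [OF bounded_linear_qform], of r A v] by simp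

text \<open>Takes the place of a Cauchy-Schwarz argument: it makes the zeros of a nonnegative form
  closed under addition.\<close>

lemma qform_parallelogram:
  "qform A (u + v) + qform A (u - v) = 2 * qform A u + 2 * qform A v"
  by (simp add: qform_def matrix_vector_right_distrib matrix_vector_mult_diff_distrib
      cdot_add_left cdot_add_right cdot_diff_left cdot_diff_right)

lemma qform_axis: "qform A (axis k 1) = Re (A $ k $ k)"
proof -
  have "(A *v axis k 1) $ k = (\<Sum>j\<in>UNIV. if j = k then A $ k $ j else 0)"
    by (simp add: matrix_vector_mult_def axis_def if_distrib cong: if_cong)
  then show ?thesis by (simp add: qform_def cdot_axis_left)
qed

lemma ketbra_mult_vec: "ketbra u *v v = cdot u v *s u"
  by (simp add: vec_eq_iff ketbra_def matrix_vector_mult_def cdot_def sum_distrib_left mult_ac)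

lemma qform_ketbra: "qform (ketbra u) v = (norm (cdot v u))\<^sup>2"
proof -
  have "cdot v (ketbra u *v v) = cdot v u * cnj (cdot v u)"
    by (simp add: ketbra_mult_vec cdot_scale_right cdot_commute [of u v])
  then show ?thesis by (simp add: qform_def complex_mult_cnj cmod_power2)
qed

lemma rank_one_projector_ketbra:
  assumes "norm u = 1"
  shows "rank_one_projector (ketbra u)"
proof -
  have "cdot u u = 1" using assms by (simp add: cdot_self)
  have "ketbra u ** ketbra u = ketbra u"
    by (simp add: matrix_eq matrix_vector_mul_assoc [symmetric] ketbra_mult_vec cdot_scale_right
        \<open>cdot u u = 1\<close>)
  moreover have "hadjoint (ketbra u) = ketbra u"
    by (simp add: hadjoint_def ketbra_def vec_eq_iff mult.commute)
  moreover have "rank (ketbra u) = 1"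
  proof -
    have "u \<noteq> 0" using assms by auto
    then obtain k where k: "u $ k \<noteq> 0" by (auto simp: vec_eq_iff)
    \<comment> \<open>Each row of \<open>ketbra u\<close> is a multiple of the entrywise conjugate
      of \<open>u\<close>, and row \<open>k\<close>, with nonzero factor \<open>u $ k\<close>,
      recovers it. So the row space is a line.\<close>
    define w where "w = (\<chi> j. cnj (u $ j))"
    have "w \<noteq> 0" using k by (auto simp: w_def vec_eq_iff)
    have row: "row i (ketbra u) = u $ i *s w" for i
      by (simp add: vec_eq_iff row_def ketbra_def w_def)
    have "vec.span (rows (ketbra u)) = vec.span {w}"
    proof (rule vec.span_eq [THEN iffD2], intro conjI)
      show "rows (ketbra u) \<subseteq> vec.span {w}"
        by (auto simp: rows_def row intro: vec.span_scale vec.span_base)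
      have "row k (ketbra u) \<in> vec.span (rows (ketbra u))"
        by (rule vec.span_base) (auto simp: rows_def)
      then have "(1 / u $ k) *s (u $ k *s w) \<in> vec.span (rows (ketbra u))"
        unfolding row by (rule vec.span_scale)
      then show "{w} \<subseteq> vec.span (rows (ketbra u))"
        using k by simp
    qed
    then have "vec.dim (rows (ketbra u)) = vec.dim {w}"
      by (metis vec.dim_span)
    also have "\<dots> = 1"
      using \<open>w \<noteq> 0\<close> by (simp add: vec.dim_eq_card_independent)
    finally show ?thesis by (simp add: row_rank_def_gen)
  qed
  ultimately show ?thesis by (simp add: rank_one_projector_def)
qed

subsection \<open>Local hidden states of pure steered states\<close>

text \<open>One Gram-Schmidt step: \<open>z\<close> is the component of \<open>u\<close> orthogonal
  to \<open>v\<close>. For \<open>v = 0\<close> the quotient is 0 by convention and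
  \<open>z = u\<close>.\<close>

lemma exists_orthogonal_separating:
  assumes "\<And>c. u \<noteq> c *s v"
  obtains z where "cdot z v = 0" and "cdot z u \<noteq> 0"
proof
  define z where "z = u - (cdot v u / cdot v v) *s v"
  have "cdot v z = 0"
    by (cases "v = 0") (auto simp: z_def cdot_diff_right cdot_scale_right cdot_def [of 0])
  then show zv: "cdot z v = 0" by (simp add: cdot_commute [of z v])
  have "u = z + (cdot v u / cdot v v) *s v" by (simp add: z_def)
  then have "cdot z u = cdot z z"
    by (metis add.right_neutral cdot_add_right cdot_scale_right mult_zero_right zv)
  moreover have "z \<noteq> 0" using assms by (simp add: z_def)
  ultimately show "cdot z u \<noteq> 0" by simp
qed

text \<open>The orthogonal complements of \<open>u\<close> and \<open>v\<close> together span the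
  space, and the form vanishes on sums of its zeros.\<close>

lemma psd_qform_eq_0:
  assumes "psd \<rho>" and "\<And>c. u \<noteq> c *s v"
    and u: "\<And>z. cdot z u = 0 \<Longrightarrow> qform \<rho> z = 0"
    and v: "\<And>z. cdot z v = 0 \<Longrightarrow> qform \<rho> z = 0"
  shows "qform \<rho> e = 0"
proof -
  obtain z where z: "cdot z v = 0" "cdot z u \<noteq> 0"
    using exists_orthogonal_separating assms(2) by blast
  \<comment> \<open>The factor gives \<open>z'\<close> the same product with \<open>u\<close> as
    \<open>e\<close> has, so \<open>e\<close> splits into \<open>e - z'\<close> orthogonal to
    \<open>u\<close> and \<open>z'\<close> orthogonal to \<open>v\<close>.\<close>
  define z' where "z' = cnj (cdot e u / cdot z u) *s z"
  have "cdot (e - z') u = 0"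
    using z(2) by (simp add: z'_def cdot_diff_left cdot_scale_left)
  then have 1: "qform \<rho> (e - z') = 0" by (rule u)
  have "cdot z' v = 0" using z(1) by (simp add: z'_def cdot_scale_left)
  then have 2: "qform \<rho> z' = 0" by (rule v)
  \<comment> \<open>The values at \<open>e\<close> and at \<open>e - z' - z'\<close> are nonnegative
    and add up to 0.\<close>
  show ?thesis
    using qform_parallelogram [of \<rho> "e - z'" z'] 1 2 psd_qform_nonneg [OF assms(1), of e]
      psd_qform_nonneg [OF assms(1), of "e - z' - z'"]
    by simp
qed

text \<open>The hypotheses confine the support of \<open>\<rho>\<close> to the line of
  \<open>u\<close> and to that of \<open>v\<close>. If \<open>u\<close> were not a multiple of
  \<open>v\<close>, all diagonal entries would have real part 0, against trace 1.\<close>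

lemma density_operator_pure_support_unique:
  assumes "density_operator \<rho>"
    and "\<And>z. cdot z u = 0 \<Longrightarrow> qform \<rho> z = 0"
    and "\<And>z. cdot z v = 0 \<Longrightarrow> qform \<rho> z = 0"
  shows "\<exists>c. u = c *s v"
proof (rule ccontr)
  assume "\<nexists>c. u = c *s v"
  then have "qform \<rho> e = 0" for e
    using psd_qform_eq_0 [of \<rho> u v e] assms by (auto simp: density_operator_def)
  then have "Re (trace \<rho>) = 0"
    by (simp add: trace_def qform_axis [symmetric])
  then show False using assms(1) by (simp add: density_operator_def)
qed

lemma LHS_pure_clicks_bound:
  assumes lhs: "admits_LHS_model X \<sigma>" and "1 \<le> X"
    and click: "\<And>x. x < X \<Longrightarrow> \<sigma> x Click = r *\<^sub>R ketbra (\<phi> x)"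
    and total: "\<And>x. x < X \<Longrightarrow> \<sigma> x Click + \<sigma> x Null = \<tau>"
    and nonpar: "\<And>x y c. \<lbrakk>x < X; y < X; x \<noteq> y\<rbrakk> \<Longrightarrow> \<phi> x \<noteq> c *s \<phi> y"
  shows "(\<Sum>x<X. qform (\<sigma> x Click) w) \<le> qform \<tau> w"
proof -
  obtain p \<rho> P where p: "\<And>l. 0 \<le> p l"
    and \<rho>: "\<And>l. density_operator (\<rho> l)"
    and P: "\<And>l x a. x < X \<Longrightarrow> 0 \<le> P l x a"
      "\<And>l x. x < X \<Longrightarrow> P l x Click + P l x Null = 1"
    and S: "\<And>x a. x < X \<Longrightarrow> (\<lambda>l. (p l * P l x a) *\<^sub>R \<rho> l) sums \<sigma> x a"
    using lhs unfolding admits_LHS_model_def by blast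
  have q: "0 \<le> qform (\<rho> l) z" for l z
    using \<rho> by (simp add: density_operator_def psd_qform_nonneg)
  have Q: "(\<lambda>l. p l * P l x a * qform (\<rho> l) z) sums qform (\<sigma> x a) z" if "x < X" for x a z
    using bounded_linear.sums [OF bounded_linear_qform S [OF that]] by (simp add: qform_scaleR)
  \<comment> \<open>Extremality of pure states: on vectors orthogonal to \<open>\<phi> x\<close> a
    series of nonnegative terms sums to 0, so every term is 0.\<close>
  have orth: "qform (\<rho> l) z = 0"
    if "x < X" "0 < p l * P l x Click" "cdot z (\<phi> x) = 0" for l x z
  proof -
    have "(\<lambda>l. p l * P l x Click * qform (\<rho> l) z) sums 0"
      using Q [OF that(1), of Click z] that(3) by (simp add: click [OF that(1)] qform_scaleR qform_ketbra)
    then have "p l * P l x Click * qform (\<rho> l) z = 0"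
      using suminf_eq_zero_iff [of "\<lambda>l. p l * P l x Click * qform (\<rho> l) z"] p P(1) [OF that(1)] q
      by (simp add: sums_iff)
    then show ?thesis using that(2) by auto
  qed
  \<comment> \<open>A hidden state clicking with positive weight for two settings would tie two
    non-parallel vectors together, so at most one term of the sum survives.\<close>
  have single: "p l * (\<Sum>x<X. P l x Click) \<le> p l" for l
  proof (cases "\<exists>x<X. 0 < p l * P l x Click")
    case True
    then obtain x where x: "x < X" "0 < p l * P l x Click" by blast
    have others: "p l * P l y Click = 0" if "y < X" "y \<noteq> x" for y
    proof (rule ccontr)
      assume "p l * P l y Click \<noteq> 0"
      then have "0 < p l * P l y Click"
        using p [of l] P(1) [OF that(1), of l Click] by (simp add: less_le)
      then have "\<exists>c. \<phi> y = c *s \<phi> x"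
        using density_operator_pure_support_unique [OF \<rho>] orth x that(1) by blast
      then show False using nonpar that x(1) by blast
    qed
    have "p l * (\<Sum>x<X. P l x Click) = (\<Sum>y<X. p l * P l y Click)"
      by (rule sum_distrib_left)
    also have "\<dots> = (\<Sum>y\<in>{x}. p l * P l y Click)"
      using x(1) others by (intro sum.mono_neutral_right) auto
    also have "\<dots> \<le> p l"
      using P(1) [OF x(1), of l Null] P(2) [OF x(1), of l] p [of l] by (simp add: mult_left_le)
    finally show ?thesis .
  next
    case False
    then have "(\<Sum>x<X. p l * P l x Click) \<le> 0"
      by (intro sum_nonpos) (meson lessThan_iff not_less)
    then show ?thesis using p [of l] by (simp add: sum_distrib_left)
  qed
  have lhs_sums: "(\<lambda>l. p l * (\<Sum>x<X. P l x Click) * qform (\<rho> l) w) sums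
      (\<Sum>x<X. qform (\<sigma> x Click) w)"
  proof -
    have "(\<lambda>l. \<Sum>x<X. p l * P l x Click * qform (\<rho> l) w) sums (\<Sum>x<X. qform (\<sigma> x Click) w)"
      by (intro sums_sum Q) simp
    then show ?thesis by (simp add: sum_distrib_left sum_distrib_right)
  qed
  have rhs_sums: "(\<lambda>l. p l * qform (\<rho> l) w) sums qform \<tau> w"
  proof -
    \<comment> \<open>\<open>\<tau>\<close> is the same for all settings; setting 0, which exists
      because \<open>X\<close> is positive, serves to expand it.\<close>
    have "0 < X" using \<open>1 \<le> X\<close> by simp
    have "p l * P l 0 Click * qform (\<rho> l) w + p l * P l 0 Null * qform (\<rho> l) w
        = p l * (P l 0 Click + P l 0 Null) * qform (\<rho> l) w" for l
      by (simp add: algebra_simps)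
    then show ?thesis
      using sums_add [OF Q [OF \<open>0 < X\<close>, of Click w] Q [OF \<open>0 < X\<close>, of Null w]] P(2) [OF \<open>0 < X\<close>]
      by (simp add: qform_add [symmetric] total [OF \<open>0 < X\<close>])
  qed
  show ?thesis
    by (rule sums_le [OF _ lhs_sums rhs_sums]) (simp add: single q mult_right_mono)
qed

subsection \<open>The assemblage of a bipartite pure state\<close>

lemma assemblage_nth:
  "assemblage \<Psi> E x a $ j $ l = (\<Sum>i\<in>UNIV. \<Sum>i'\<in>UNIV. E x a $ i $ i' * \<Psi> $ (i', j) * cnj (\<Psi> $ (i, l)))"
proof -
  have "(\<Sum>k\<in>UNIV. E x a $ i $ fst k * mat 1 $ j $ snd k * (\<Psi> $ k * cnj (\<Psi> $ (i, l))))
      = (\<Sum>i'\<in>UNIV. E x a $ i $ i' * \<Psi> $ (i', j) * cnj (\<Psi> $ (i, l)))" for i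
  proof -
    have "(\<Sum>k\<in>UNIV. E x a $ i $ fst k * mat 1 $ j $ snd k * (\<Psi> $ k * cnj (\<Psi> $ (i, l))))
      = (\<Sum>i'\<in>UNIV. \<Sum>j'\<in>UNIV. E x a $ i $ i' * mat 1 $ j $ j' * (\<Psi> $ (i', j') * cnj (\<Psi> $ (i, l))))"
      by (simp add: UNIV_Times_UNIV [symmetric] sum.cartesian_product' case_prod_beta
          del: UNIV_Times_UNIV)
    also have "\<dots> = (\<Sum>i'\<in>UNIV. \<Sum>j'\<in>UNIV. if j = j' then E x a $ i $ i' * \<Psi> $ (i', j) * cnj (\<Psi> $ (i, l)) else 0)"
      by (intro sum.cong refl) (simp add: mat_def)
    finally show ?thesis by simp
  qed
  then show ?thesis
    by (simp add: assemblage_def partial_trace_A_def tensor_op_def ketbra_def matrix_matrix_mult_def)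
qed

text \<open>A column of the coefficient matrix of \<open>\<Psi>\<close>, with rows indexed by
  Alice's basis and columns by Bob's.\<close>

definition bipartite_column :: "complex ^ ('a::finite \<times> 'b::finite) \<Rightarrow> 'b \<Rightarrow> complex ^ 'a" where
  "bipartite_column \<Psi> j = (\<chi> i. \<Psi> $ (i, j))"

text \<open>Bob's unnormalised state after Alice projects onto \<open>u\<close>: the partial inner
  product of \<open>u\<close> with \<open>\<Psi>\<close>, antilinear in \<open>u\<close>.\<close>

definition steered_vec :: "complex ^ ('a::finite \<times> 'b::finite) \<Rightarrow> complex ^ 'a \<Rightarrow> complex ^ 'b" where
  "steered_vec \<Psi> u = (\<chi> j. cdot u (bipartite_column \<Psi> j))"

lemma assemblage_ketbra:
  assumes "E x a = r *\<^sub>R ketbra u"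
  shows "assemblage \<Psi> E x a = r *\<^sub>R ketbra (steered_vec \<Psi> u)"
proof -
  have "assemblage \<Psi> E x a $ j $ l = r *\<^sub>R ketbra (steered_vec \<Psi> u) $ j $ l" for j l
    unfolding assemblage_nth assms
    by (simp add: ketbra_def steered_vec_def bipartite_column_def cdot_def sum_product)
      (subst sum.swap, simp add: scaleR_conv_of_real sum_distrib_left mult_ac)
  then show ?thesis by (simp add: vec_eq_iff)
qed

text \<open>No-signalling: the right-hand side is Bob's reduced state, a Gram matrix of columns that
  does not involve \<open>x\<close>.\<close>

lemma assemblage_total:
  assumes "E x Click + E x Null = mat 1"
  shows "assemblage \<Psi> E x Click + assemblage \<Psi> E x Null
    = (\<chi> j l. cdot (bipartite_column \<Psi> l) (bipartite_column \<Psi> j))"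
proof -
  have E: "E x Click $ i $ i' + E x Null $ i $ i' = (if i = i' then 1 else 0)" for i i'
    using assms by (simp add: vec_eq_iff mat_def)
  have "assemblage \<Psi> E x Click $ j $ l + assemblage \<Psi> E x Null $ j $ l
      = cdot (bipartite_column \<Psi> l) (bipartite_column \<Psi> j)" for j l
  proof -
    have "assemblage \<Psi> E x Click $ j $ l + assemblage \<Psi> E x Null $ j $ l
      = (\<Sum>i\<in>UNIV. \<Sum>i'\<in>UNIV. (E x Click $ i $ i' + E x Null $ i $ i') * (\<Psi> $ (i', j) * cnj (\<Psi> $ (i, l))))"
      by (simp add: assemblage_nth sum.distrib [symmetric] algebra_simps)
    also have "\<dots> = (\<Sum>i\<in>UNIV. \<Sum>i'\<in>UNIV. if i = i' then \<Psi> $ (i, j) * cnj (\<Psi> $ (i, l)) else 0)"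
      unfolding E by (intro sum.cong refl) auto
    also have "\<dots> = cdot (bipartite_column \<Psi> l) (bipartite_column \<Psi> j)"
      by (simp add: cdot_def bipartite_column_def mult.commute)
    finally show ?thesis .
  qed
  then show ?thesis by (simp add: vec_eq_iff)
qed

text \<open>The coefficient matrix has rank at least 2: were all columns multiples
  \<open>c l\<close> of one column, that column and the vector of the \<open>c l\<close> would
  factor \<open>\<Psi>\<close>.\<close>

lemma entangled_independent_columns:
  assumes "entangled \<Psi>"
  obtains k l where "bipartite_column \<Psi> k \<noteq> 0"
    and "\<And>c. bipartite_column \<Psi> l \<noteq> c *s bipartite_column \<Psi> k"
proof -
  have "\<Psi> \<noteq> tensor_vec 0 0" using assms by (auto simp: entangled_def)
  then obtain i k where "\<Psi> $ (i, k) \<noteq> 0"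
    by (auto simp: vec_eq_iff tensor_vec_def)
  then have k: "bipartite_column \<Psi> k \<noteq> 0"
    by (auto simp: bipartite_column_def vec_eq_iff)
  have "\<exists>l. \<forall>c. bipartite_column \<Psi> l \<noteq> c *s bipartite_column \<Psi> k"
  proof (rule ccontr)
    assume "\<not> ?thesis"
    then obtain c where c: "\<And>l. bipartite_column \<Psi> l = c l *s bipartite_column \<Psi> k" by metis
    have "\<Psi> $ (i, l) = bipartite_column \<Psi> k $ i * c l" for i l
      using arg_cong [OF c [of l], of "\<lambda>u. u $ i"] by (simp add: bipartite_column_def mult.commute)
    then have "\<Psi> = tensor_vec (bipartite_column \<Psi> k) (\<chi> l. c l)"
      by (auto simp: vec_eq_iff tensor_vec_def)
    then show False using assms by (auto simp: entangled_def)
  qed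
  then show ?thesis using that k by blast
qed

text \<open>The kernel of the antilinear map \<open>steered_vec \<Psi>\<close> is the orthogonal
  complement of the columns, so the map is injective on their span. Antilinearity conjugates
  \<open>c\<close>.\<close>

lemma steered_vec_parallel:
  assumes "steered_vec \<Psi> u = c *s steered_vec \<Psi> v"
    and "u \<in> vec.span (range (bipartite_column \<Psi>))"
    and "v \<in> vec.span (range (bipartite_column \<Psi>))"
  shows "u = cnj c *s v"
proof -
  define z where "z = u - cnj c *s v"
  have col: "cdot z (bipartite_column \<Psi> j) = 0" for j
    using arg_cong [OF assms(1), of "\<lambda>w. w $ j"]
    by (simp add: z_def steered_vec_def cdot_diff_left cdot_scale_left)
  have "z \<in> vec.span (range (bipartite_column \<Psi>))"
    unfolding z_def by (intro vec.span_diff vec.span_scale assms)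
  moreover have "cdot z w = 0" if "w \<in> vec.span (range (bipartite_column \<Psi>))" for w
    using that
    by (induction rule: vec.span_induct_alt)
      (auto simp: col cdot_add_right cdot_scale_right cdot_def [of _ 0])
  ultimately have "cdot z z = 0" by blast
  then show ?thesis by (simp add: z_def)
qed

subsection \<open>Nearly equal measurement directions\<close>

text \<open>Comparing coefficients of the independent vectors \<open>v\<close> and \<open>u\<close>
  gives \<open>a = c * b\<close> and \<open>c = 1\<close>.\<close>

lemma independent_pencil_parallel:
  assumes "u \<noteq> 0" and indep: "\<And>c. v \<noteq> c *s u"
    and par: "u + a *s v = c *s (u + b *s v)"
  shows "a = (b :: 'a :: field)"
proof -
  have eq: "(a - c * b) *s v = (c - 1) *s u"
    using par by (simp add: vec_eq_iff) (simp add: algebra_simps)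
  have "a - c * b = 0"
  proof (rule ccontr)
    assume "a - c * b \<noteq> 0"
    then have "v = ((c - 1) / (a - c * b)) *s u"
      using arg_cong [OF eq, of "\<lambda>w. (1 / (a - c * b)) *s w"]
      by (simp only: vector_smult_assoc) simp
    then show False using indep by blast
  qed
  moreover have "c = 1"
    using eq calculation \<open>u \<noteq> 0\<close> by (metis eq_iff_diff_eq_0 vector_mul_eq_0)
  ultimately show ?thesis by simp
qed

lemma close_nonparallel_directions:
  fixes u v :: "complex ^ 'n" and \<epsilon> :: real
  assumes "u \<noteq> 0" and indep: "\<And>c. v \<noteq> c *s u" and "1 < \<epsilon> * real X"
  obtains \<pi> where "\<And>x. norm (\<pi> x) = 1"
    and "\<And>x. \<pi> x \<in> vec.span {u, v}"
    and "\<And>x y c. x \<noteq> y \<Longrightarrow> \<pi> x \<noteq> c *s \<pi> y"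
    and "(norm u)\<^sup>2 < \<epsilon> * (\<Sum>x<X. (norm (cdot (\<pi> x) u))\<^sup>2)"
proof -
  \<comment> \<open>The right-hand side of the last claim for the normalised directions
    \<open>u + t x v\<close>. As \<open>t\<close> tends to 0 each summand tends to the squared norm
    of \<open>u\<close>.\<close>
  define f where "f t = \<epsilon> * (\<Sum>x<X. (cmod (cdot u u + complex_of_real (t * real x) * cdot v u))\<^sup>2
      / (norm (u + (t * real x) *\<^sub>R v))\<^sup>2)" for t
  have "(f \<longlongrightarrow> \<epsilon> * (\<Sum>x<X. (cmod (cdot u u + complex_of_real (0 * real x) * cdot v u))\<^sup>2
      / (norm (u + (0 * real x) *\<^sub>R v))\<^sup>2)) (at_right 0)"
    unfolding f_def by (intro tendsto_intros) (use \<open>u \<noteq> 0\<close> in simp)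
  moreover have "(cmod (cdot u u))\<^sup>2 / (norm u)\<^sup>2 = (norm u)\<^sup>2"
    using \<open>u \<noteq> 0\<close> by (simp add: cdot_self norm_power norm_mult power2_eq_square)
  ultimately have lim: "(f \<longlongrightarrow> \<epsilon> * real X * (norm u)\<^sup>2) (at_right 0)"
    by (simp add: mult.assoc)
  have "(norm u)\<^sup>2 < \<epsilon> * real X * (norm u)\<^sup>2"
    using assms(1,3) by simp
  \<comment> \<open>The strict inequality at the limit persists for small \<open>t\<close>;
    \<open>t > 0\<close> keeps the directions distinct.\<close>
  then have "eventually (\<lambda>t. (norm u)\<^sup>2 < f t \<and> 0 < t) (at_right 0)"
    by (intro eventually_conj order_tendstoD(1) [OF lim]) (simp_all add: eventually_at_right_less)
  then obtain t where t: "(norm u)\<^sup>2 < f t" "0 < t"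
    using eventually_happens' [OF trivial_limit_at_right_real] by blast
  define w where "w x = u + complex_of_real (t * real x) *s v" for x
  define \<pi> where "\<pi> x = complex_of_real (1 / norm (w x)) *s w x" for x
  have w0: "w x \<noteq> 0" for x
  proof
    assume "w x = 0"
    then have "w x = 0 *s w (Suc x)" by simp
    then have "complex_of_real (t * real x) = complex_of_real (t * real (Suc x))"
      unfolding w_def by (rule independent_pencil_parallel [OF assms(1,2)])
    then show False using t(2) unfolding of_real_eq_iff by simp
  qed
  show ?thesis
  proof
    show "norm (\<pi> x) = 1" for x
      using w0 by (simp only: \<pi>_def scaleR_eq_vector_scalar_mult [symmetric]) simp
    show "\<pi> x \<in> vec.span {u, v}" for x
      unfolding \<pi>_def w_def
      by (intro vec.span_scale vec.span_add) (auto intro: vec.span_base)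
    show "\<pi> x \<noteq> c *s \<pi> y" if "x \<noteq> y" for x y c
    proof
      assume eq: "\<pi> x = c *s \<pi> y"
      have "w x = complex_of_real (norm (w x)) *s \<pi> x"
        using w0 [of x] by (simp add: \<pi>_def)
      also have "\<dots> = (complex_of_real (norm (w x)) * c * complex_of_real (1 / norm (w y))) *s w y"
        unfolding eq by (simp add: \<pi>_def mult.assoc)
      finally have "complex_of_real (t * real x) = complex_of_real (t * real y)"
        unfolding w_def by (rule independent_pencil_parallel [OF assms(1,2)])
      then show False using t(2) that unfolding of_real_eq_iff by simp
    qed
    have "(norm (cdot (\<pi> x) u))\<^sup>2 = (cmod (cdot u u + complex_of_real (t * real x) * cdot v u))\<^sup>2
      / (norm (u + (t * real x) *\<^sub>R v))\<^sup>2" for x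
      by (simp add: \<pi>_def cdot_scale_left norm_mult norm_divide power_divide)
        (simp add: w_def cdot_add_left cdot_scale_left scaleR_eq_vector_scalar_mult)
    then show "(norm u)\<^sup>2 < \<epsilon> * (\<Sum>x<X. (norm (cdot (\<pi> x) u))\<^sup>2)"
      using t(1) by (simp add: f_def)
  qed
qed

theorem theorem3:
  fixes \<Psi> :: "complex ^ ('a::finite \<times> 'b::finite)"
    and X :: nat
    and \<epsilon> :: real
  assumes "pure_state \<Psi>" and "entangled \<Psi>"
    and "X \<ge> 1"
    and "0 \<le> \<epsilon>" and "\<epsilon> \<le> 1"
    and "\<epsilon> > 1 / real X"
  shows "\<exists>E :: nat \<Rightarrow> outcome \<Rightarrow> complex ^ 'a ^ 'a.
           one_click_measurements X \<epsilon> E \<and>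
           inj_on (\<lambda>x. E x Click) {..<X} \<and>
           demonstrates_steering X (assemblage \<Psi> E)"
proof -
  obtain k l where u0: "bipartite_column \<Psi> k \<noteq> 0"
    and indep: "\<And>c. bipartite_column \<Psi> l \<noteq> c *s bipartite_column \<Psi> k"
    using entangled_independent_columns [OF assms(2)] by blast
  define u where "u = bipartite_column \<Psi> k"
  have "1 < \<epsilon> * real X"
    using assms(3,6) by (simp add: field_simps)
  then obtain \<pi> where norm: "\<And>x. norm (\<pi> x) = 1"
    and span: "\<And>x. \<pi> x \<in> vec.span {u, bipartite_column \<Psi> l}"
    and nonpar: "\<And>x y c. x \<noteq> y \<Longrightarrow> \<pi> x \<noteq> c *s \<pi> y"
    and violation: "(norm u)\<^sup>2 < \<epsilon> * (\<Sum>x<X. (norm (cdot (\<pi> x) u))\<^sup>2)"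
    using close_nonparallel_directions [OF u0 indep] unfolding u_def by blast
  define E where "E x a = (case a of Click \<Rightarrow> \<epsilon> *\<^sub>R ketbra (\<pi> x) | Null \<Rightarrow> mat 1 - \<epsilon> *\<^sub>R ketbra (\<pi> x))"
    for x :: nat and a
  have "one_click_measurements X \<epsilon> E"
    unfolding one_click_measurements_def
    by (rule exI [of _ "\<lambda>x. ketbra (\<pi> x)"]) (simp add: E_def rank_one_projector_ketbra norm)
  moreover have "inj_on (\<lambda>x. E x Click) {..<X}"
  proof (rule inj_onI, rule ccontr)
    fix x y assume "E x Click = E y Click" and "x \<noteq> y"
    then have "ketbra (\<pi> x) = ketbra (\<pi> y)"
      using \<open>1 < \<epsilon> * real X\<close> by (auto simp: E_def)
    then have "cdot (\<pi> x) (\<pi> x) *s \<pi> x = cdot (\<pi> y) (\<pi> x) *s \<pi> y"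
      by (metis ketbra_mult_vec)
    then show False
      using nonpar [OF \<open>x \<noteq> y\<close>] by (simp add: cdot_self norm)
  qed
  moreover have "\<not> admits_LHS_model X (assemblage \<Psi> E)"
  proof
    assume lhs: "admits_LHS_model X (assemblage \<Psi> E)"
    have click: "assemblage \<Psi> E x Click = \<epsilon> *\<^sub>R ketbra (steered_vec \<Psi> (\<pi> x))" for x
      by (rule assemblage_ketbra) (simp add: E_def)
    have "vec.span {u, bipartite_column \<Psi> l} \<subseteq> vec.span (range (bipartite_column \<Psi>))"
      unfolding u_def by (rule vec.span_mono) auto
    then have steered: "steered_vec \<Psi> (\<pi> x) \<noteq> c *s steered_vec \<Psi> (\<pi> y)" if "x \<noteq> y" for x y c
      using steered_vec_parallel [of \<Psi> "\<pi> x" c "\<pi> y"] nonpar [OF that] span by blast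
    have "(\<Sum>x<X. qform (assemblage \<Psi> E x Click) (axis k 1))
      \<le> qform (\<chi> j l. cdot (bipartite_column \<Psi> l) (bipartite_column \<Psi> j)) (axis k 1)"
      by (rule LHS_pure_clicks_bound [OF lhs assms(3) click assemblage_total steered])
        (simp_all add: E_def)
    then have "\<epsilon> * (\<Sum>x<X. (norm (cdot (\<pi> x) u))\<^sup>2) \<le> (norm u)\<^sup>2"
      by (simp add: click qform_scaleR qform_ketbra cdot_axis_left steered_vec_def sum_distrib_left
          u_def) (simp add: qform_axis cdot_self)
    then show False using violation by simp
  qed
  ultimately show ?thesis
    unfolding demonstrates_steering_def by blast
qed

end
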